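(* The convergence exponent $\lambda^* \colon [0,1] \to [0,1]$ has the intermediate value property, i.e., for any $x, y \in [0,1]$ with $x<y$ and $\lambda^*(x) \neq \lambda^*(y)$, if $c$ is strictly between $\lambda^*(x)$ and $\lambda^*(y)$, then there exists $z \in (x,y)$ such that $\lambda^*(z) = c$.
   Context: Pierce digits. For $x \in [0,1]$, define $d_1(x) := \lfloor 1/x \rfloor$ and $T(x) := 1 - d_1(x)\,x$ if $x \neq 0$, and $d_1(0) := \infty$, $T(0) := 0$. Here $\lfloor y \rfloor$ is the largest integer not exceeding $y$. For $n \in \mathbb{N} = \{1,2,3,\dots\}$ put $d_n(x) := d_1(T^{n-1}(x))$, where $T^{n-1}$ is the $(n-1)$-fold iterate of $T$ ($T^0$ is the identity). The sequence $(d_n(x))_{n \in \mathbb{N}}$ is the Pierce expansion digit sequence of $x$. Conventions: $\infty^s := \infty$ for $s>0$ and $c/\infty := 0$ for $c \in \mathbb{R}$. Convergence exponent: for $x \in [0,1]$, $\lambda^*(x) := \inf\{ s > 0 : \sum_{n \in \mathbb{N}} 1/(d_n(x))^s \text{ converges} \}$. The function $\lambda^*$ takes values in $[0,1]$. *)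

theory Defs
  imports "HOL-Analysis.Analysis" "HOL-Library.Extended_Nat"
begin

definition pierce_d1 :: "real \<Rightarrow> enat" where
  "pierce_d1 x = (if x = 0 then \<infinity> else enat (nat \<lfloor>1 / x\<rfloor>))"

definition pierce_T :: "real \<Rightarrow> real" where
  "pierce_T x = (if x = 0 then 0 else 1 - of_int \<lfloor>1 / x\<rfloor> * x)"

text \<open>Digits are indexed from 1, so the value at index 0 is never used.\<close>

definition pierce_digit :: "nat \<Rightarrow> real \<Rightarrow> enat" where
  "pierce_digit n x = pierce_d1 ((pierce_T ^^ (n - 1)) x)"

text \<open>The value of \<open>1 / d\<^sup>s\<close>, with the conventions \<open>\<infinity>\<^sup>s = \<infinity>\<close> and
  \<open>1 / \<infinity> = 0\<close>.\<close>

definition inverse_enat_powr :: "enat \<Rightarrow> real \<Rightarrow> real" where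
  "inverse_enat_powr d s = (case d of enat k \<Rightarrow> 1 / real k powr s | \<infinity> \<Rightarrow> 0)"

definition admissible_exponents :: "real \<Rightarrow> real set" where
  "admissible_exponents x =
     {s. s > 0 \<and> summable (\<lambda>n. inverse_enat_powr (pierce_digit (Suc n) x) s)}"

text \<open>The infimum is taken in the reals. It is a genuine one: the set is bounded below
  by 0, and nonempty by \<open>admissible_exponents_nonempty\<close> below.\<close>

definition convergence_exponent :: "real \<Rightarrow> real" where
  "convergence_exponent x = Inf (admissible_exponents x)"

lemma pierce_T_bounds:
  assumes "0 < x" "x \<le> 1"
  shows "0 \<le> pierce_T x" and "real_of_int \<lfloor>1 / x\<rfloor> \<ge> 1" and "pierce_T x \<le> 1"
    and "pierce_T x * (real_of_int \<lfloor>1 / x\<rfloor> + 1) < 1"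
proof -
  define k where "k = real_of_int \<lfloor>1 / x\<rfloor>"
  have k1: "k \<le> 1 / x" and k2: "1 / x < k + 1" unfolding k_def by linarith+
  have "\<lfloor>1 / x\<rfloor> \<ge> 1" using assms by simp
  then show kpos: "real_of_int \<lfloor>1 / x\<rfloor> \<ge> 1" by linarith
  have a: "k * x \<le> 1" and b: "1 < (k + 1) * x" using k1 k2 assms by (simp_all add: field_simps)
  have T: "pierce_T x = 1 - k * x" using assms by (simp add: pierce_T_def k_def)
  show "0 \<le> pierce_T x" using a T by simp
  show "pierce_T x \<le> 1" using T kpos assms unfolding k_def[symmetric] by simp
  have "k * 1 < k * ((k + 1) * x)" using b kpos unfolding k_def[symmetric] by (intro mult_strict_left_mono) auto
  then show "pierce_T x * (real_of_int \<lfloor>1 / x\<rfloor> + 1) < 1"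
    unfolding T k_def[symmetric] by (simp add: algebra_simps)
qed

lemma pierce_T_iterate:
  assumes "x \<in> {0..1}"
  shows "0 \<le> (pierce_T ^^ n) x \<and> (pierce_T ^^ n) x * real (Suc n) \<le> 1"
proof (induction n)
  case 0
  show ?case using assms by simp
next
  case (Suc n)
  define y where "y = (pierce_T ^^ n) x"
  show ?case
  proof (cases "y = 0")
    case True
    then have "pierce_T y = 0" by (simp add: pierce_T_def)
    then show ?thesis by (simp add: y_def)
  next
    case False
    have y: "0 < y" "y * real (Suc n) \<le> 1" using Suc False by (auto simp: y_def)
    have "y * 1 \<le> y * real (Suc n)" using y by (intro mult_left_mono) auto
    then have y1: "y \<le> 1" using y by linarith
    have "real (Suc n) \<le> 1 / y" using y by (simp add: field_simps)
    then have "int (Suc n) \<le> \<lfloor>1 / y\<rfloor>" by (simp add: le_floor_iff)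
    then have "real (Suc (Suc n)) \<le> real_of_int \<lfloor>1 / y\<rfloor> + 1" by linarith
    then have "pierce_T y * real (Suc (Suc n)) \<le> pierce_T y * (real_of_int \<lfloor>1 / y\<rfloor> + 1)"
      using pierce_T_bounds(1)[OF y(1) y1] by (rule mult_left_mono)
    also have "\<dots> < 1" by (rule pierce_T_bounds(4)[OF y(1) y1])
    finally show ?thesis using pierce_T_bounds(1)[OF y(1) y1] by (simp add: y_def)
  qed
qed

lemma pierce_digit_ge:
  assumes "x \<in> {0..1}" "n \<ge> 1"
  shows "enat n \<le> pierce_digit n x"
proof -
  define y where "y = (pierce_T ^^ (n - 1)) x"
  show ?thesis
  proof (cases "y = 0")
    case True
    then show ?thesis by (simp add: pierce_digit_def pierce_d1_def y_def)
  next
    case False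
    have "0 < y" "y * real n \<le> 1"
      using pierce_T_iterate[OF assms(1), of "n - 1"] False assms(2) by (auto simp: y_def)
    then have "real n \<le> 1 / y" by (simp add: field_simps)
    then have "int n \<le> \<lfloor>1 / y\<rfloor>" by (simp add: le_floor_iff)
    then have "n \<le> nat \<lfloor>1 / y\<rfloor>" by linarith
    then show ?thesis using False by (simp add: pierce_digit_def pierce_d1_def y_def)
  qed
qed

lemma admissible_exponents_nonempty:
  assumes "x \<in> {0..1}"
  shows "admissible_exponents x \<noteq> {}"
proof -
  have "summable (\<lambda>n. inverse_enat_powr (pierce_digit (Suc n) x) 2)"
  proof (rule summable_comparison_test')
    show "summable (\<lambda>n. inverse ((real (Suc n)) ^ 2))"
      using inverse_power_summable[of 2, where 'a = real]
      by (subst summable_Suc_iff[of "\<lambda>n. inverse (real n ^ 2)"]) simp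
  next
    fix n :: nat
    assume "n \<ge> 0"
    have ge: "enat (Suc n) \<le> pierce_digit (Suc n) x" using pierce_digit_ge[OF assms, of "Suc n"] by simp
    show "norm (inverse_enat_powr (pierce_digit (Suc n) x) 2) \<le> inverse ((real (Suc n)) ^ 2)"
    proof (cases "pierce_digit (Suc n) x")
      case (enat k)
      then have "Suc n \<le> k" using ge by simp
      then have "real (Suc n) ^ 2 \<le> real k ^ 2" by (intro power_mono) auto
      then have "inverse (real k ^ 2) \<le> inverse (real (Suc n) ^ 2)" by (intro le_imp_inverse_le) auto
      moreover have "real k > 0" using \<open>Suc n \<le> k\<close> by simp
      ultimately show ?thesis using enat by (simp add: inverse_enat_powr_def inverse_eq_divide)
    qed (simp add: inverse_enat_powr_def)
  qed
  then have "2 \<in> admissible_exponents x" by (simp add: admissible_exponents_def)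
  then show ?thesis by blast
qed

end

theory Submission
  imports Defs
begin

text \<open>
  Every value \<open>c \<in> (0, 1)\<close> is attained by the convergence exponent in every nonempty open
  subinterval of \<open>[0, 1]\<close>, so the two values at the end points matter only in forcing
  \<open>c\<close> to lie strictly between \<open>0\<close> and \<open>1\<close>. Two facts are behind this.

  First, the exponent is a tail property of the digit sequence: it does not change when finitely
  many digits are removed (\<open>convergence_exponent_pierce_T_iterate\<close>). An irrational \<open>w\<close> has
  infinitely many digits, and its first \<open>N\<close> digits can be followed by the expansion of any
  sufficiently small \<open>t > 0\<close>; the resulting point is within \<open>1 / (N + 1)\<close> of \<open>w\<close>
  (\<open>pierce_prefix_transplant\<close>).

  Second, arbitrarily small \<open>t\<close> with exponent \<open>c\<close> exist
  (\<open>exists_small_convergence_exponent\<close>). Every strictly increasing sequence of integers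
  \<open>b\<^sub>0 < b\<^sub>1 < \<dots>\<close> with \<open>b\<^sub>0 \<ge> 2\<close> is the digit sequence of the alternating series
  \<open>1/b\<^sub>0 - 1/(b\<^sub>0 b\<^sub>1) + 1/(b\<^sub>0 b\<^sub>1 b\<^sub>2) - \<dots>\<close>, and digits
  growing like \<open>n\<^sup>p\<close> with \<open>p = 1 / c\<close> turn the defining series of the exponent into the
  Riemann series \<open>\<Sum> n\<^sup>-\<^sup>p\<^sup>s\<close>, which converges exactly for \<open>s > c\<close>. A large \<open>b\<^sub>0\<close>
  makes the point small.
\<close>

section \<open>Basic properties of the convergence exponent\<close>

lemma summable_powr_Suc_iff:
  fixes a :: real
  shows "summable (\<lambda>n. real (Suc n) powr a) \<longleftrightarrow> a < -1"
  by (subst summable_Suc_iff[of "\<lambda>n. real n powr a"]) (rule summable_real_powr_iff)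

text \<open>The digits satisfy \<open>d\<^sub>n \<ge> n\<close>, so the series is dominated by \<open>\<Sum> n\<^sup>-\<^sup>s\<close>.\<close>

lemma admissible_exponents_gt_1:
  assumes x: "x \<in> {0..1}" and s: "s > 1"
  shows "s \<in> admissible_exponents x"
proof -
  have "summable (\<lambda>n. inverse_enat_powr (pierce_digit (Suc n) x) s)"
  proof (rule summable_comparison_test')
    show "summable (\<lambda>n. real (Suc n) powr (-s))"
      using s by (simp only: summable_powr_Suc_iff)
  next
    fix n :: nat
    assume "n \<ge> 0"
    have ge: "enat (Suc n) \<le> pierce_digit (Suc n) x"
      using pierce_digit_ge[OF x, of "Suc n"] by simp
    show "norm (inverse_enat_powr (pierce_digit (Suc n) x) s) \<le> real (Suc n) powr (-s)"
    proof (cases "pierce_digit (Suc n) x")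
      case (enat k)
      then have "real (Suc n) \<le> real k" using ge by simp
      then have "real k powr (-s) \<le> real (Suc n) powr (-s)"
        using s by (intro powr_mono2') auto
      then show ?thesis using enat by (simp add: inverse_enat_powr_def powr_minus_divide)
    qed (simp add: inverse_enat_powr_def)
  qed
  then show ?thesis using s by (simp add: admissible_exponents_def)
qed

lemma convergence_exponent_bounds:
  assumes x: "x \<in> {0..1}"
  shows "convergence_exponent x \<in> {0..1}"
proof -
  have pos: "0 < s" if "s \<in> admissible_exponents x" for s
    using that by (simp add: admissible_exponents_def)
  have "0 \<le> convergence_exponent x"
    unfolding convergence_exponent_def
    using admissible_exponents_nonempty[OF x] pos by (intro cInf_greatest) (auto intro: less_imp_le)
  moreover have "bdd_below (admissible_exponents x)"
    using pos by (intro bdd_belowI[of _ 0]) (auto intro: less_imp_le)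
  then have "convergence_exponent x \<le> s" if "s > 1" for s
    unfolding convergence_exponent_def
    using admissible_exponents_gt_1[OF x that] by (rule cInf_lower[rotated])
  then have "convergence_exponent x \<le> 1" by (rule dense_ge)
  ultimately show ?thesis by simp
qed

lemma convergence_exponent_pierce_T_iterate:
  "convergence_exponent ((pierce_T ^^ N) x) = convergence_exponent x"
proof -
  have "pierce_digit (Suc n) ((pierce_T ^^ N) x) = pierce_digit (Suc (n + N)) x" for n
    by (simp add: pierce_digit_def funpow_add)
  then have "admissible_exponents ((pierce_T ^^ N) x) = admissible_exponents x"
    using summable_iff_shift[of "\<lambda>n. inverse_enat_powr (pierce_digit (Suc n) x) s" N for s]
    by (simp add: admissible_exponents_def)
  then show ?thesis by (simp add: convergence_exponent_def)
qed

text \<open>The two-sided growth bound on the digits makes the defining series comparable with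
  \<open>\<Sum> n\<^sup>-\<^sup>p\<^sup>s\<close>.\<close>

lemma convergence_exponent_of_power_growth:
  assumes digit: "\<And>n. pierce_digit (Suc n) x = enat (b n)"
    and p: "p > 0" and C: "C > 0"
    and lower: "\<And>n. real (Suc n) powr p \<le> real (b n)"
    and upper: "\<And>n. real (b n) \<le> C * real (Suc n) powr p"
  shows "convergence_exponent x = 1 / p"
proof -
  have term_eq: "inverse_enat_powr (pierce_digit (Suc n) x) s = real (b n) powr (-s)" for n s
    by (simp add: digit inverse_enat_powr_def powr_minus_divide)
  have bpos: "0 < real (b n)" for n
    by (rule less_le_trans[OF _ lower]) simp
  have "summable (\<lambda>n. real (b n) powr (-s)) \<longleftrightarrow> 1 / p < s" if s: "s > 0" for s
  proof -
    have iff: "summable (\<lambda>n. real (Suc n) powr (p * (-s))) \<longleftrightarrow> 1 / p < s"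
      unfolding summable_powr_Suc_iff using p by (simp add: field_simps)
    have le: "real (b n) powr (-s) \<le> real (Suc n) powr (p * (-s))" for n
      using powr_mono2'[OF _ _ lower, of "-s" n] s by (simp add: powr_powr)
    have ge: "C powr (-s) * real (Suc n) powr (p * (-s)) \<le> real (b n) powr (-s)" for n
      using powr_mono2'[OF _ bpos upper, of "-s" n] s C by (simp add: powr_mult powr_powr)
    have "summable (\<lambda>n. real (Suc n) powr (p * (-s)))" if "summable (\<lambda>n. real (b n) powr (-s))"
    proof -
      have "summable (\<lambda>n. C powr (-s) * real (Suc n) powr (p * (-s)))"
        using ge by (intro summable_comparison_test'[OF that, of 0]) simp
      then show ?thesis using C by (simp add: summable_cmult_iff)
    qed
    moreover have "summable (\<lambda>n. real (b n) powr (-s))"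
      if "summable (\<lambda>n. real (Suc n) powr (p * (-s)))"
      using le by (intro summable_comparison_test'[OF that, of 0]) simp
    ultimately show ?thesis using iff by blast
  qed
  moreover have "0 < s" if "1 / p < s" for s
    using p that less_trans[of 0 "1 / p" s] by simp
  ultimately have "admissible_exponents x = {1 / p<..}"
    unfolding admissible_exponents_def term_eq by auto
  then show ?thesis by (simp add: convergence_exponent_def)
qed

section \<open>Points with prescribed digits\<close>

text \<open>The map \<open>t \<mapsto> (1 - t) / d\<close> is the inverse branch of \<open>pierce_T\<close> on the points with
  first digit \<open>d\<close>.\<close>

lemma pierce_inverse_branch:
  assumes d: "d \<ge> 1" and t: "0 \<le> t" "t < 1 / (real d + 1)"
  defines "z \<equiv> (1 - t) / real d"
  shows "0 < z" "pierce_d1 z = enat d" "pierce_T z = t"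
proof -
  have lt: "t * (real d + 1) < 1" using t by (simp add: field_simps)
  have t1: "t < 1"
    using t(2) by (rule less_le_trans) simp
  show z: "0 < z" using t1 d by (simp add: z_def)
  have "real d * (1 - t) \<le> real d" using t d by (intro mult_left_le) auto
  moreover have "real d < (real d + 1) * (1 - t)" using lt by (simp add: algebra_simps)
  ultimately have "\<lfloor>1 / z\<rfloor> = int d"
    using t1 by (intro floor_unique) (simp_all add: z_def field_simps)
  then show "pierce_d1 z = enat d" "pierce_T z = t"
    using z d by (simp_all add: pierce_d1_def pierce_T_def) (simp add: z_def)
qed

text \<open>The points \<open>t k\<close> are the alternating series belonging to the shifted sequences
  \<open>b k, b (k + 1), \<dots>\<close>; splitting off the first term gives \<open>t k = (1 - t (k + 1)) / b k\<close>.
  Domination by a geometric series gives \<open>t k \<le> 1\<close>, and the recursion turns this into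
  \<open>0 < t k < 1 / b k\<close>, which is what places each \<open>t (k + 1)\<close> in the domain of the inverse
  branch with digit \<open>b k\<close>.\<close>

lemma exists_pierce_digits:
  fixes b :: "nat \<Rightarrow> nat"
  assumes b2: "\<And>n. b n \<ge> 2" and inc: "\<And>n. b n < b (Suc n)"
  obtains x where "0 < x" "x < 1 / real (b 0)" "\<And>n. pierce_digit (Suc n) x = enat (b n)"
proof -
  define a where "a k j = (-1) ^ j / (\<Prod>i\<le>j. real (b (k + i)))" for k j
  define t where "t k = (\<Sum>j. a k j)" for k
  have a_bound: "norm (a k j) \<le> (1 / 2) * (1 / 2) ^ j" for k j
  proof -
    have "(\<Prod>i\<le>j. (2::real)) \<le> (\<Prod>i\<le>j. real (b (k + i)))"
      using b2 by (intro prod_mono) auto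
    then have "2 * 2 ^ j \<le> (\<Prod>i\<le>j. real (b (k + i)))" by simp
    then have "1 / (\<Prod>i\<le>j. real (b (k + i))) \<le> 1 / (2 * 2 ^ j)"
      by (intro divide_left_mono) (auto intro!: mult_pos_pos intro: less_le_trans[rotated])
    then show ?thesis
      by (simp add: a_def power_divide abs_prod norm_divide norm_power)
  qed
  have geo: "(\<lambda>j. (1 / 2) * (1 / 2) ^ j :: real) sums 1"
    using sums_mult[OF geometric_sums[of "1 / 2 :: real"], of "1 / 2"] by simp
  have summable: "summable (a k)" for k
    using a_bound by (intro summable_comparison_test'[OF sums_summable[OF geo], of 0]) auto
  have le1: "t k \<le> 1" for k
  proof -
    have "t k \<le> (\<Sum>j. (1 / 2) * (1 / 2) ^ j)"
      unfolding t_def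
      using a_bound[of k] by (intro suminf_le summable sums_summable[OF geo])
        (metis abs_le_D1 real_norm_def)
    also have "\<dots> = 1" using geo by (simp add: sums_iff)
    finally show ?thesis .
  qed
  have bpos: "real (b k) > 0" for k using b2[of k] by simp
  have rec: "t k = (1 - t (Suc k)) / real (b k)" for k
  proof -
    have split: "a k (Suc j) = - (1 / real (b k)) * a (Suc k) j" for j
      by (simp add: a_def prod.atMost_Suc_shift del: prod.atMost_Suc)
    have "t k = a k 0 + (\<Sum>j. a k (Suc j))"
      unfolding t_def using suminf_split_head[OF summable, of k] by simp
    also have "(\<Sum>j. a k (Suc j)) = - (1 / real (b k)) * t (Suc k)"
      unfolding split t_def by (rule suminf_mult[OF summable])
    finally show ?thesis by (simp add: a_def diff_divide_distrib)
  qed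
  have nonneg: "0 \<le> t k" for k
    using le1[of "Suc k"] bpos[of k] by (subst rec) simp
  have "t k \<le> 1 / real (b k)" for k
    using nonneg[of "Suc k"] bpos[of k] by (subst rec) (simp add: divide_right_mono)
  moreover have "1 / real (b k) < 1" for k using b2[of k] by simp
  ultimately have "t k < 1" for k by (rule le_less_trans)
  then have pos: "0 < t k" for k
    using bpos[of k] by (subst rec) simp
  have upper: "t k < 1 / real (b k)" for k
    using pos[of "Suc k"] bpos[of k] by (subst rec) (simp add: divide_strict_right_mono)
  have branch: "pierce_d1 (t k) = enat (b k)" "pierce_T (t k) = t (Suc k)" for k
  proof -
    have "1 / real (b (Suc k)) \<le> 1 / (real (b k) + 1)"
      using inc[of k] by (intro divide_left_mono) auto
    then have "t (Suc k) < 1 / (real (b k) + 1)" using upper[of "Suc k"] by simp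
    moreover have "b k \<ge> 1" using b2[of k] by simp
    ultimately show "pierce_d1 (t k) = enat (b k)" "pierce_T (t k) = t (Suc k)"
      using pierce_inverse_branch[of "b k" "t (Suc k)"] nonneg[of "Suc k"]
      by (simp_all add: rec[of k, symmetric])
  qed
  have iterate: "(pierce_T ^^ n) (t 0) = t n" for n
    by (induction n) (simp_all add: branch)
  show ?thesis
  proof
    show "0 < t 0" "t 0 < 1 / real (b 0)" by (rule pos upper)+
    show "pierce_digit (Suc n) (t 0) = enat (b n)" for n
      by (simp add: pierce_digit_def iterate branch)
  qed
qed

text \<open>The digits are \<open>K + n + \<lfloor>n\<^sup>p\<rfloor>\<close> for \<open>n = 1, 2, \<dots>\<close> and \<open>p = 1 / c\<close>: the
  summand \<open>K\<close> forces the point to be small and the summand \<open>n\<close> makes the sequence strictly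
  increasing. Since \<open>p \<ge> 1\<close>, neither affects the order of growth.\<close>

lemma exists_small_convergence_exponent:
  assumes c: "0 < c" "c \<le> 1" and \<delta>: "\<delta> > 0"
  obtains t where "0 < t" "t < \<delta>" "convergence_exponent t = c"
proof -
  define p where "p = 1 / c"
  have p: "p \<ge> 1" using c by (simp add: p_def)
  obtain K :: nat where K: "1 / \<delta> < real K" using reals_Archimedean2 by blast
  define b where "b n = K + Suc n + nat \<lfloor>real (Suc n) powr p\<rfloor>" for n
  have ge_1: "1 \<le> real (Suc n) powr p" for n
    using p by (intro ge_one_powr_ge_zero) auto
  have b_real: "real (b n) = real K + real (Suc n) + of_int \<lfloor>real (Suc n) powr p\<rfloor>" for n
    by (simp add: b_def)
  have b2: "b n \<ge> 2" for n
    using ge_1[of n] unfolding b_def by linarith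
  have inc: "b n < b (Suc n)" for n
  proof -
    have "real (Suc n) powr p \<le> real (Suc (Suc n)) powr p"
      using p by (intro powr_mono2) auto
    then have "nat \<lfloor>real (Suc n) powr p\<rfloor> \<le> nat \<lfloor>real (Suc (Suc n)) powr p\<rfloor>"
      by (intro nat_mono floor_mono)
    then show ?thesis by (simp add: b_def)
  qed
  obtain x where x: "0 < x" "x < 1 / real (b 0)" "\<And>n. pierce_digit (Suc n) x = enat (b n)"
    using exists_pierce_digits[of b, OF b2 inc] by blast
  have lower: "real (Suc n) powr p \<le> real (b n)" for n
    unfolding b_real by linarith
  have upper: "real (b n) \<le> (real K + 2) * real (Suc n) powr p" for n
  proof -
    have "real K * 1 \<le> real K * real (Suc n) powr p"
      using ge_1 by (intro mult_left_mono) auto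
    moreover have "real (Suc n) \<le> real (Suc n) powr p"
      using powr_mono[OF p, of "real (Suc n)"] by simp
    moreover have "of_int \<lfloor>real (Suc n) powr p\<rfloor> \<le> real (Suc n) powr p" by linarith
    ultimately show ?thesis unfolding b_real distrib_right by linarith
  qed
  have "convergence_exponent x = 1 / p"
    using p by (intro convergence_exponent_of_power_growth[OF x(3) _ _ lower upper]) auto
  moreover have "x < \<delta>"
  proof -
    have "1 / \<delta> < real (b 0)" using K by (simp add: b_def)
    moreover have "0 < real (b 0)" using b2[of 0] by simp
    ultimately have "1 / real (b 0) < \<delta>" using \<delta> by (simp add: field_simps)
    then show ?thesis using x(2) by simp
  qed
  ultimately show ?thesis using that x(1) by (simp add: p_def)
qed

section \<open>Approximation by points with a prescribed tail\<close>

lemma pierce_T_iterate_in_unit: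
  assumes "x \<in> {0..1}"
  shows "(pierce_T ^^ N) x \<in> {0..1}"
proof -
  define u where "u = (pierce_T ^^ N) x"
  have u: "0 \<le> u" "u * real (Suc N) \<le> 1"
    using pierce_T_iterate[OF assms, of N] by (simp_all add: u_def)
  have "u * 1 \<le> u * real (Suc N)" using u(1) by (intro mult_left_mono) auto
  then show ?thesis using u unfolding u_def[symmetric] by simp
qed

lemma pierce_T_iterate_irrational:
  assumes w: "w \<in> {0..1}" "w \<notin> \<rat>"
  shows "(pierce_T ^^ N) w \<notin> \<rat>"
proof (induction N)
  case (Suc N)
  define u where "u = (pierce_T ^^ N) w"
  have irr: "u \<notin> \<rat>" using Suc by (simp add: u_def)
  then have "u \<noteq> 0" by auto
  then have "0 < u" "u \<le> 1"
    using pierce_T_iterate_in_unit[OF w(1), of N] by (auto simp: u_def)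
  then have d: "real_of_int \<lfloor>1 / u\<rfloor> \<ge> 1" by (rule pierce_T_bounds(2))
  have "pierce_T u \<notin> \<rat>"
  proof
    assume *: "pierce_T u \<in> \<rat>"
    have "of_int \<lfloor>1 / u\<rfloor> \<noteq> (0::real)" using d by linarith
    then have "u = (1 - pierce_T u) / of_int \<lfloor>1 / u\<rfloor>"
      using \<open>u \<noteq> 0\<close> by (simp add: pierce_T_def)
    also have "\<dots> \<in> \<rat>" using * by (intro Rats_divide Rats_diff) auto
    finally show False using irr by simp
  qed
  then show ?case by (simp add: u_def)
qed (use w in simp)

text \<open>The inverse branches for the first \<open>N\<close> digits of \<open>w\<close> are composed. For \<open>N \<ge> 1\<close> the
  integer \<open>m\<close> is \<open>d\<^sub>N(w) + 1\<close>, the least possible next digit, and \<open>(0, 1 / m)\<close> is the range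
  of tails that may follow. Each branch has slope \<open>-1/d\<close>, so distances do not grow under the
  composition.\<close>

lemma pierce_prefix_transplant:
  assumes w: "w \<in> {0..1}" "w \<notin> \<rat>"
  shows "\<exists>m::nat. Suc N \<le> m \<and> (pierce_T ^^ N) w < 1 / real m \<and>
    (\<forall>t. 0 < t \<and> t < 1 / real m \<longrightarrow>
      (\<exists>z. (pierce_T ^^ N) z = t \<and> \<bar>z - w\<bar> \<le> \<bar>t - (pierce_T ^^ N) w\<bar>))"
proof (induction N)
  case 0
  have "w \<noteq> 1" using w(2) by auto
  then have "w < 1" using w(1) by simp
  then show ?case by (intro exI[of _ 1]) auto
next
  case (Suc N)
  define u where "u = (pierce_T ^^ N) w"
  from Suc obtain m :: nat where m: "Suc N \<le> m" "u < 1 / real m"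
    and lift: "\<And>t. 0 < t \<Longrightarrow> t < 1 / real m \<Longrightarrow> \<exists>z. (pierce_T ^^ N) z = t \<and> \<bar>z - w\<bar> \<le> \<bar>t - u\<bar>"
    unfolding u_def by blast
  have "u \<noteq> 0" using pierce_T_iterate_irrational[OF w, of N] by (auto simp: u_def)
  then have u: "0 < u" "u \<le> 1"
    using pierce_T_iterate_in_unit[OF w(1), of N] by (auto simp: u_def)
  define d where "d = nat \<lfloor>1 / u\<rfloor>"
  have "real m < 1 / u" using u m by (simp add: field_simps)
  then have dm: "m \<le> d" unfolding d_def by linarith
  then have d1: "1 \<le> d" using m by simp
  then have d: "real_of_int \<lfloor>1 / u\<rfloor> = real d" by (simp add: d_def)
  have Tu: "pierce_T u = 1 - real d * u" using u by (simp add: pierce_T_def d)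
  have "pierce_T u < 1 / real (Suc d)"
    using pierce_T_bounds(4)[OF u] by (simp add: d field_simps)
  moreover have "\<exists>z. (pierce_T ^^ Suc N) z = t \<and> \<bar>z - w\<bar> \<le> \<bar>t - pierce_T u\<bar>"
    if t: "0 < t" "t < 1 / real (Suc d)" for t
  proof -
    define t' where "t' = (1 - t) / real d"
    have t': "0 < t'" "pierce_T t' = t"
      using pierce_inverse_branch[of d t] d1 t by (simp_all add: t'_def add.commute)
    have "t' < 1 / real d" using t d1 by (simp add: t'_def divide_strict_right_mono)
    also have "\<dots> \<le> 1 / real m" using dm m by (intro divide_left_mono) auto
    finally obtain z where z: "(pierce_T ^^ N) z = t'" "\<bar>z - w\<bar> \<le> \<bar>t' - u\<bar>"
      using lift t' by blast
    have "real d * t' = 1 - t" using d1 by (simp add: t'_def)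
    then have "t - pierce_T u = - (real d * (t' - u))"
      by (simp add: Tu right_diff_distrib)
    then have "\<bar>t - pierce_T u\<bar> = real d * \<bar>t' - u\<bar>" by (simp add: abs_mult)
    moreover have "1 * \<bar>t' - u\<bar> \<le> real d * \<bar>t' - u\<bar>"
      using d1 by (intro mult_right_mono) auto
    ultimately have "\<bar>z - w\<bar> \<le> \<bar>t - pierce_T u\<bar>" using z(2) by simp
    then show ?thesis using z(1) t'(2) by (intro exI[of _ z]) simp
  qed
  ultimately show ?case
    using dm m by (intro exI[of _ "Suc d"]) (auto simp: u_def[symmetric])
qed

lemma convergence_exponent_attained_in_interval:
  assumes xy: "0 \<le> x" "x < y" "y \<le> 1" and c: "0 < c" "c \<le> 1"
  obtains z where "z \<in> {x<..<y}" "convergence_exponent z = c"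
proof -
  obtain w where w: "w \<in> {x<..<y}" "w \<notin> \<rat>"
    using real_interval_avoid_countable_set[OF xy(2) countable_rat] by blast
  then have w01: "w \<in> {0..1}" using xy by simp
  define \<epsilon> where "\<epsilon> = min (w - x) (y - w)"
  have "\<epsilon> > 0" using w by (simp add: \<epsilon>_def)
  then obtain N where N: "1 / real (Suc N) < \<epsilon>"
    using nat_approx_posE by metis
  define u where "u = (pierce_T ^^ N) w"
  obtain m :: nat where m: "Suc N \<le> m" "u < 1 / real m"
    and lift: "\<And>t. 0 < t \<Longrightarrow> t < 1 / real m \<Longrightarrow> \<exists>z. (pierce_T ^^ N) z = t \<and> \<bar>z - w\<bar> \<le> \<bar>t - u\<bar>"
    using pierce_prefix_transplant[OF w01 w(2), of N] unfolding u_def by blast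
  have "1 / real m > 0" using m by simp
  then obtain t where t: "0 < t" "t < 1 / real m" "convergence_exponent t = c"
    using exists_small_convergence_exponent[OF c] by blast
  obtain z where z: "(pierce_T ^^ N) z = t" "\<bar>z - w\<bar> \<le> \<bar>t - u\<bar>"
    using lift t by blast
  have "0 \<le> u" using pierce_T_iterate_in_unit[OF w01, of N] by (simp add: u_def)
  then have "\<bar>t - u\<bar> < 1 / real m" using t m by linarith
  also have "\<dots> \<le> 1 / real (Suc N)" using m by (intro divide_left_mono) auto
  finally have "\<bar>z - w\<bar> < \<epsilon>" using z N by linarith
  then have "z \<in> {x<..<y}" by (auto simp: \<epsilon>_def abs_less_iff)
  moreover have "convergence_exponent z = c"
    using convergence_exponent_pierce_T_iterate[of N z] z t by simp
  ultimately show ?thesis by (rule that)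
qed

theorem corollary1p3:
  "convergence_exponent ` {0..1} \<subseteq> {0..1} \<and>
   (\<forall>x \<in> {0..1}. \<forall>y \<in> {0..1}. \<forall>c :: real.
      x < y \<longrightarrow> convergence_exponent x \<noteq> convergence_exponent y \<longrightarrow>
      (convergence_exponent x < c \<and> c < convergence_exponent y \<or>
       convergence_exponent y < c \<and> c < convergence_exponent x) \<longrightarrow>
      (\<exists>z \<in> {x<..<y}. convergence_exponent z = c))"
proof (intro conjI ballI allI impI)
  show "convergence_exponent ` {0..1} \<subseteq> {0..1}"
    using convergence_exponent_bounds by blast
next
  fix x y c :: real
  assume xy: "x \<in> {0..1}" "y \<in> {0..1}" "x < y"
    and c: "convergence_exponent x < c \<and> c < convergence_exponent y \<or>
      convergence_exponent y < c \<and> c < convergence_exponent x"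
  have "0 < c" "c \<le> 1"
    using c convergence_exponent_bounds[OF xy(1)] convergence_exponent_bounds[OF xy(2)] by auto
  then show "\<exists>z \<in> {x<..<y}. convergence_exponent z = c"
    using xy by (auto intro: convergence_exponent_attained_in_interval[of x y c])
qed

end
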